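(* Let $\mathcal H$ be a complex separable infinite dimensional Hilbert space and let $\Phi:\ell_\infty(\mathbb N,\mathcal B(\mathcal H))\to\mathcal B(\mathcal H)$ be an irreducible Jordan homomorphism. Then there is a positive integer $n$ such that $$\ker\Phi=\{(A_k)_k\in\ell_\infty(\mathbb N,\mathcal B(\mathcal H)) : A_n=0\}.$$
   Context: $\mathcal B(\mathcal H)$ denotes the $C^*$-algebra of all bounded linear operators on $\mathcal H$. $\ell_\infty(\mathbb N,\mathcal B(\mathcal H))=\{(A_n)_n : A_n\in\mathcal B(\mathcal H)\ (n\in\mathbb N),\ \sup_n\|A_n\|<\infty\}$ is a $C^*$-algebra with coordinatewise operations and the supremum norm. If $\mathcal R$ and $\mathcal R'$ are algebras, a linear map $\phi:\mathcal R\to\mathcal R'$ is called a Jordan homomorphism if $\phi(A)^2=\phi(A^2)$ for every $A\in\mathcal R$. A Jordan homomorphism $\Phi$ into $\mathcal B(\mathcal H)$ is called irreducible if its range has only trivial invariant subspaces, i.e. the only closed subspaces of $\mathcal H$ that are invariant under every operator in the range of $\Phi$ are $\{0\}$ and $\mathcal H$. *)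

theory Defs
  imports "HOL-Analysis.Analysis"
begin

section \<open>Complex vector spaces and algebras\<close>

class scaleC =
  fixes scaleC :: "complex \<Rightarrow> 'a \<Rightarrow> 'a" (infixr "*\<^sub>C" 75)

class complex_vector = real_vector + scaleC +
  assumes scaleC_add_right: "a *\<^sub>C (x + y) = a *\<^sub>C x + a *\<^sub>C y"
    and scaleC_add_left: "(a + b) *\<^sub>C x = a *\<^sub>C x + b *\<^sub>C x"
    and scaleC_scaleC: "a *\<^sub>C b *\<^sub>C x = (a * b) *\<^sub>C x"
    and scaleC_one: "1 *\<^sub>C x = x"
    and scaleR_scaleC: "r *\<^sub>R x = complex_of_real r *\<^sub>C x"

global_interpretation complex_vector:
  vector_space "scaleC :: complex \<Rightarrow> 'a \<Rightarrow> 'a::complex_vector"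
  by unfold_locales (rule scaleC_add_right scaleC_add_left scaleC_scaleC scaleC_one)+

class complex_normed_vector = complex_vector + real_normed_vector +
  assumes norm_scaleC: "norm (a *\<^sub>C x) = cmod a * norm x"

class complex_algebra = complex_vector + real_algebra +
  assumes mult_scaleC_left: "(a *\<^sub>C x) * y = a *\<^sub>C (x * y)"
    and mult_scaleC_right: "x * (a *\<^sub>C y) = a *\<^sub>C (x * y)"

class complex_normed_algebra = complex_normed_vector + complex_algebra + real_normed_algebra

lemma bounded_linear_scaleC: "bounded_linear (\<lambda>x::'a::complex_normed_vector. c *\<^sub>C x)"
  by (rule bounded_linear_intro[where K = "cmod c"])
    (auto simp: scaleC_add_right scaleR_scaleC scaleC_scaleC norm_scaleC mult.commute)


section \<open>Complex Hilbert spaces\<close>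

text \<open>The inner product is linear in its first argument. Completeness is part of
  \<^class>\<open>complete_space\<close>, for the metric induced by the norm.\<close>

class complex_hilbert_space = complex_normed_vector + complete_space +
  fixes cinner :: "'a \<Rightarrow> 'a \<Rightarrow> complex"
  assumes cinner_add_left: "cinner (x + y) z = cinner x z + cinner y z"
    and cinner_scaleC_left: "cinner (a *\<^sub>C x) y = a * cinner x y"
    and cinner_commute: "cinner x y = cnj (cinner y x)"
    and cinner_self_nonneg: "0 \<le> Re (cinner x x)"
    and cinner_self_eq_zero: "cinner x x = 0 \<longleftrightarrow> x = 0"
    and norm_eq_sqrt_cinner: "norm x = sqrt (Re (cinner x x))"


section \<open>The algebra of bounded operators\<close>

text \<open>The library type \<open>'a \<Rightarrow>\<^sub>L 'a\<close> consists of the bounded real-linear maps; the bounded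
  operators are the complex-linear ones among them, with the same operator norm.\<close>

typedef (overloaded) 'a bounded_op =
  "{A :: 'a::complex_normed_vector \<Rightarrow>\<^sub>L 'a. \<forall>c x. A (c *\<^sub>C x) = c *\<^sub>C A x}"
  by (rule exI[of _ 0]) simp

setup_lifting type_definition_bounded_op

lift_definition op_apply :: "'a::complex_normed_vector bounded_op \<Rightarrow> 'a \<Rightarrow> 'a"
  is blinfun_apply .

lemma bounded_op_eqI: "(\<And>x. op_apply A x = op_apply B x) \<Longrightarrow> A = B"
  by transfer (rule blinfun_eqI)

lemma op_apply_scaleC: "op_apply A (c *\<^sub>C x) = c *\<^sub>C op_apply A x"
  by transfer simp

lemma bounded_linear_op_apply: "bounded_linear (op_apply A)"
  by transfer (rule blinfun.bounded_linear_right)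

lemma ex_op_apply_eq_iff:
  "(\<exists>A. op_apply A = f) \<longleftrightarrow> bounded_linear f \<and> (\<forall>c x. f (c *\<^sub>C x) = c *\<^sub>C f x)"
proof
  assume "\<exists>A. op_apply A = f"
  then show "bounded_linear f \<and> (\<forall>c x. f (c *\<^sub>C x) = c *\<^sub>C f x)"
    using bounded_linear_op_apply op_apply_scaleC by blast
next
  assume f: "bounded_linear f \<and> (\<forall>c x. f (c *\<^sub>C x) = c *\<^sub>C f x)"
  then have "blinfun_apply (Blinfun f) = f"
    by (simp add: bounded_linear_Blinfun_apply)
  with f have "op_apply (Abs_bounded_op (Blinfun f)) = f"
    by (simp add: op_apply.rep_eq Abs_bounded_op_inverse)
  then show "\<exists>A. op_apply A = f" ..
qed

instantiation bounded_op :: (complex_normed_vector) complex_normed_algebra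
begin

lift_definition zero_bounded_op :: "'a bounded_op" is 0
  by simp

lift_definition plus_bounded_op :: "'a bounded_op \<Rightarrow> 'a bounded_op \<Rightarrow> 'a bounded_op" is "(+)"
  by (simp add: blinfun.add_left scaleC_add_right)

lift_definition minus_bounded_op :: "'a bounded_op \<Rightarrow> 'a bounded_op \<Rightarrow> 'a bounded_op" is "(-)"
  by (simp add: blinfun.diff_left complex_vector.scale_right_diff_distrib)

lift_definition uminus_bounded_op :: "'a bounded_op \<Rightarrow> 'a bounded_op" is uminus
  by (simp add: blinfun.minus_left)

lift_definition scaleR_bounded_op :: "real \<Rightarrow> 'a bounded_op \<Rightarrow> 'a bounded_op" is "scaleR"
  by (simp add: blinfun.scaleR_left scaleR_scaleC scaleC_scaleC mult.commute)

lift_definition scaleC_bounded_op :: "complex \<Rightarrow> 'a bounded_op \<Rightarrow> 'a bounded_op"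
  is "\<lambda>c (A :: 'a \<Rightarrow>\<^sub>L 'a). Blinfun (\<lambda>x. c *\<^sub>C blinfun_apply A x)"
  by (subst (1 2) bounded_linear_Blinfun_apply)
    (auto intro: bounded_linear_compose[OF bounded_linear_scaleC] blinfun.bounded_linear_right
      simp: scaleC_scaleC mult.commute)

lift_definition times_bounded_op :: "'a bounded_op \<Rightarrow> 'a bounded_op \<Rightarrow> 'a bounded_op" is "(o\<^sub>L)"
  by simp

lift_definition norm_bounded_op :: "'a bounded_op \<Rightarrow> real" is norm .

definition dist_bounded_op :: "'a bounded_op \<Rightarrow> 'a bounded_op \<Rightarrow> real"
  where "dist_bounded_op A B = norm (A - B)"

definition sgn_bounded_op :: "'a bounded_op \<Rightarrow> 'a bounded_op"
  where "sgn_bounded_op A = scaleR (inverse (norm A)) A"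

definition uniformity_bounded_op :: "('a bounded_op \<times> 'a bounded_op) filter"
  where "uniformity_bounded_op = (INF e\<in>{0<..}. principal {(x, y). dist x y < e})"

definition open_bounded_op :: "'a bounded_op set \<Rightarrow> bool"
  where "open_bounded_op S = (\<forall>x\<in>S. \<forall>\<^sub>F (x', y) in uniformity. x' = x \<longrightarrow> y \<in> S)"

lemma scaleC_bounded_op_apply: "op_apply (c *\<^sub>C A) x = c *\<^sub>C op_apply A x"
  by transfer (simp add: bounded_linear_Blinfun_apply
      bounded_linear_compose[OF bounded_linear_scaleC] blinfun.bounded_linear_right)

lemma op_apply_simps:
  "op_apply 0 x = 0"
  "op_apply (A + B) x = op_apply A x + op_apply B x"
  "op_apply (A - B) x = op_apply A x - op_apply B x"
  "op_apply (- A) x = - op_apply A x"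
  "op_apply (r *\<^sub>R A) x = r *\<^sub>R op_apply A x"
  "op_apply (c *\<^sub>C A) x = c *\<^sub>C op_apply A x"
  "op_apply (A * B) x = op_apply A (op_apply B x)"
proof -
  show "op_apply (c *\<^sub>C A) x = c *\<^sub>C op_apply A x" by (rule scaleC_bounded_op_apply)
qed (transfer, simp add: blinfun.bilinear_simps)+

instance
proof
  fix A B C :: "'a bounded_op" and a b :: complex and r s :: real
  show "open S \<longleftrightarrow> (\<forall>x\<in>S. \<forall>\<^sub>F (x', y) in uniformity. x' = x \<longrightarrow> y \<in> S)"
    for S :: "'a bounded_op set"
    by (rule open_bounded_op_def)
  show "norm A = 0 \<longleftrightarrow> A = 0" by transfer simp
  show "norm (A + B) \<le> norm A + norm B" by transfer (rule norm_triangle_ineq)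
  show "norm (r *\<^sub>R A) = \<bar>r\<bar> * norm A" by transfer simp
  show "norm (A * B) \<le> norm A * norm B" by transfer (rule norm_blinfun_compose)
  show "norm (a *\<^sub>C A) = cmod a * norm A"
  proof -
    have *: "norm (c *\<^sub>C D) \<le> cmod c * norm D" for c and D :: "'a bounded_op"
      by transfer (auto intro!: norm_blinfun_bound
          simp: bounded_linear_Blinfun_apply bounded_linear_compose[OF bounded_linear_scaleC]
            blinfun.bounded_linear_right norm_scaleC mult.assoc mult_left_mono norm_blinfun)
    show ?thesis
    proof (cases "a = 0")
      case True
      then show ?thesis using *[of a A] norm_bounded_op.rep_eq[of "a *\<^sub>C A"] by simp
    next
      case False
      have "A = inverse a *\<^sub>C a *\<^sub>C A"
        using False by (intro bounded_op_eqI) (simp add: op_apply_simps scaleC_scaleC scaleC_one)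
      then have "norm A \<le> inverse (cmod a) * norm (a *\<^sub>C A)"
        using *[of "inverse a" "a *\<^sub>C A"] by (simp add: norm_inverse)
      then have "cmod a * norm A \<le> norm (a *\<^sub>C A)"
        using False by (simp add: field_simps)
      then show ?thesis using *[of a A] by simp
    qed
  qed
qed (auto intro!: bounded_op_eqI simp: op_apply_simps scaleC_add_right scaleC_add_left
    scaleC_scaleC scaleC_one scaleR_scaleC op_apply_scaleC distrib_left distrib_right
    linear_add[OF bounded_linear.linear[OF bounded_linear_op_apply]]
    dist_bounded_op_def sgn_bounded_op_def uniformity_bounded_op_def)

end


section \<open>Bounded sequences in a normed algebra\<close>

text \<open>For a normed space \<open>'b\<close>, the space of bounded sequences is the library type
  \<open>nat \<Rightarrow>\<^sub>C 'b\<close> of bounded continuous functions: \<^typ>\<open>nat\<close> is discrete, so continuity is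
  no restriction. Its norm is the supremum norm. Sequences are indexed from 0, so the
  positive integer \<open>n\<close> corresponds to the index \<open>n - 1\<close>.\<close>

type_synonym 'b ell_infty = "nat \<Rightarrow>\<^sub>C 'b"

lemma ex_ell_infty_eq_iff:
  fixes f :: "nat \<Rightarrow> 'b::real_normed_vector"
  shows "(\<exists>A :: 'b ell_infty. apply_bcontfun A = f) \<longleftrightarrow> bdd_above (range (\<lambda>n. norm (f n)))"
proof
  assume "\<exists>A :: 'b ell_infty. apply_bcontfun A = f"
  then obtain A :: "'b ell_infty" where "apply_bcontfun A = f" ..
  then have "bounded (range f)" using bounded_apply_bcontfun[of A] by simp
  then show "bdd_above (range (\<lambda>n. norm (f n)))" by (auto simp: bounded_iff bdd_above_def)
next
  assume "bdd_above (range (\<lambda>n. norm (f n)))"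
  then have "f \<in> bcontfun" by (auto simp: bcontfun_def bounded_iff bdd_above_def)
  then show "\<exists>A :: 'b ell_infty. apply_bcontfun A = f" by (metis bcontfunE)
qed

setup_lifting type_definition_bcontfun

instantiation bcontfun :: (topological_space, complex_normed_algebra) complex_algebra
begin

lift_definition scaleC_bcontfun :: "complex \<Rightarrow> ('a \<Rightarrow>\<^sub>C 'b) \<Rightarrow> 'a \<Rightarrow>\<^sub>C 'b"
  is "\<lambda>c f x. c *\<^sub>C f x"
proof (unfold bcontfun_def, safe)
  fix c and f :: "'a \<Rightarrow> 'b"
  assume "continuous_on UNIV f"
  then show "continuous_on UNIV (\<lambda>x. c *\<^sub>C f x)"
    by (rule bounded_linear.continuous_on[OF bounded_linear_scaleC])
  assume "bounded (range f)"
  then have "bounded ((\<lambda>y. c *\<^sub>C y) ` range f)"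
    by (rule bounded_linear_image[OF _ bounded_linear_scaleC])
  then show "bounded (range (\<lambda>x. c *\<^sub>C f x))"
    by (simp only: image_image)
qed

lift_definition times_bcontfun :: "('a \<Rightarrow>\<^sub>C 'b) \<Rightarrow> ('a \<Rightarrow>\<^sub>C 'b) \<Rightarrow> 'a \<Rightarrow>\<^sub>C 'b"
  is "\<lambda>f g x. f x * g x"
proof (unfold bcontfun_def, safe)
  fix f g :: "'a \<Rightarrow> 'b"
  assume "continuous_on UNIV f" "continuous_on UNIV g"
  then show "continuous_on UNIV (\<lambda>x. f x * g x)" by (rule continuous_on_mult)
  assume "bounded (range f)" "bounded (range g)"
  then obtain a b where "\<And>x. norm (f x) \<le> a" "\<And>x. norm (g x) \<le> b"
    by (auto simp: bounded_iff)
  then have "norm (f x * g x) \<le> a * b" for x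
    by (meson mult_mono' norm_ge_zero norm_mult_ineq order_trans)
  then show "bounded (range (\<lambda>x. f x * g x))" by (auto simp: bounded_iff)
qed

instance
  by standard (rule bcontfun_eqI,
      simp add: scaleC_bcontfun.rep_eq times_bcontfun.rep_eq scaleC_add_right scaleC_add_left
        scaleC_scaleC scaleC_one scaleR_scaleC mult_scaleC_left mult_scaleC_right
        distrib_left distrib_right mult.assoc)+

end


section \<open>Irreducible Jordan homomorphisms\<close>

definition jordan_homomorphism :: "('a::complex_algebra \<Rightarrow> 'b::complex_algebra) \<Rightarrow> bool"
  where "jordan_homomorphism \<phi> \<longleftrightarrow>
    Vector_Spaces.linear (*\<^sub>C) (*\<^sub>C) \<phi> \<and> (\<forall>A. \<phi> A * \<phi> A = \<phi> (A * A))"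

definition irreducible_range :: "('a \<Rightarrow> 'h::complex_normed_vector bounded_op) \<Rightarrow> bool"
  where "irreducible_range \<phi> \<longleftrightarrow>
    (\<forall>V. closed V \<and> complex_vector.subspace V \<and> (\<forall>A\<in>range \<phi>. \<forall>x\<in>V. op_apply A x \<in> V)
      \<longrightarrow> V = {0} \<or> V = UNIV)"

definition infinite_dimensional :: "'h::complex_vector itself \<Rightarrow> bool"
  where "infinite_dimensional _ \<longleftrightarrow>
    \<not> (\<exists>B::'h set. finite B \<and> complex_vector.span B = UNIV)"

end

theory Submission
  imports Defs
begin

text \<open>
  Why the theorem holds. The kernel \<open>J\<close> of a Jordan homomorphism \<open>\<Phi>\<close> is closed under
  \<open>(a, b, c) \<mapsto> a b c + c b a\<close> as soon as one of the three factors lies in \<open>J\<close>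
  (\<open>jordan_triple\<close>). Three observations determine it.

  First, if some \<open>A \<in> J\<close> has \<open>A\<^sub>n \<noteq> 0\<close>, then \<open>J\<close> contains every rank-one operator
  \<open>y \<otimes> y\<close> placed at the index \<open>n\<close>: compress \<open>A\<^sub>n\<close> to a line on which its quadratic form does
  not vanish, and move that line to any other one (\<open>kernel_contains_rank_one\<close>).

  Second, some such rank-one element lies outside \<open>J\<close> (\<open>ex_rank_one_not_in_kernel\<close>). Otherwise
  \<open>J\<close> contains all their finite linear combinations. Let the finite binary words
  label distinct vectors of an orthonormal basis of \<open>\<H>\<close>, and for an infinite binary sequence \<open>f\<close> let \<open>P\<^sub>f\<close> be the bounded
  sequence whose \<open>n\<close>-th entry projects onto the closed span of the vectors labelled by the prefixes of
  \<open>f\<close> of length at least \<open>n\<close>. Two distinct sequences share only finitely many prefixes, so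
  \<open>P\<^sub>f P\<^sub>g\<close> has finitely many nonzero entries, each of finite rank; hence \<open>P\<^sub>f P\<^sub>g \<in> J\<close>.
  On the other hand \<open>P\<^sub>f\<close> is the range projection of an isometry, so \<open>P\<^sub>f \<in> J\<close> would force
  \<open>\<Phi> = 0\<close>. The \<open>\<Phi> P\<^sub>f\<close> are thus uncountably many nonzero, pairwise orthogonal idempotents on
  \<open>\<H>\<close>. This is impossible in a separable space: vectors \<open>x\<^sub>f\<close> in their ranges satisfy
  \<open>\<parallel>x\<^sub>f - x\<^sub>g\<parallel> \<ge> \<parallel>x\<^sub>f\<parallel> / \<parallel>\<Phi> P\<^sub>f\<parallel>\<close>, a separation that depends on \<open>f\<close> only
  (\<open>orthogonal_idempotents_countable\<close>). Cutting the words at length \<open>n\<close> in the \<open>n\<close>-th entry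
  is what makes one family serve both for the tails of the sequence and for the single
  coordinates.

  Third, \<open>\<Phi>\<close> maps a central idempotent to an idempotent commuting with the range of \<open>\<Phi>\<close>,
  which by irreducibility is \<open>0\<close> or the identity (\<open>jordan_central_idempotent\<close>). For the index
  \<open>n\<close> of the second step, the identity placed at \<open>n\<close> is a central idempotent outside \<open>J\<close>, so
  \<open>\<Phi>\<close> maps it to the identity, and then \<open>\<Phi>\<close> kills every sequence that it annihilates, that is,
  every \<open>A\<close> with \<open>A\<^sub>n = 0\<close>. The converse inclusion is the first step.\<close>

section \<open>Inner products and orthonormal families\<close>

instance complex_hilbert_space \<subseteq> banach ..

lemma cinner_add_right: "cinner x (y + z) = cinner x y + cinner x z" for x :: "'h::complex_hilbert_space"
  by (metis cinner_commute cinner_add_left complex_cnj_add)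

lemma cinner_scaleC_right: "cinner x (a *\<^sub>C y) = cnj a * cinner x y" for x :: "'h::complex_hilbert_space"
  by (metis cinner_commute cinner_scaleC_left complex_cnj_mult)

lemma cinner_zero_left: "cinner 0 y = 0" for y :: "'h::complex_hilbert_space"
  using cinner_add_left[of 0 0 y] by simp

lemma cinner_zero_right: "cinner y 0 = 0" for y :: "'h::complex_hilbert_space"
  using cinner_add_right[of y 0 0] by simp

lemma cinner_minus_left: "cinner (- x) y = - cinner x y" for y :: "'h::complex_hilbert_space"
  using cinner_add_left[of x "- x" y] by (simp add: cinner_zero_left eq_neg_iff_add_eq_0 add.commute)

lemma cinner_diff_left: "cinner (x - z) y = cinner x y - cinner z y" for y :: "'h::complex_hilbert_space"
  using cinner_add_left[of x "- z" y] by (simp add: cinner_minus_left)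

lemma cinner_diff_right: "cinner y (x - z) = cinner y x - cinner y z" for y :: "'h::complex_hilbert_space"
  by (metis cinner_commute cinner_diff_left complex_cnj_diff)

lemma cinner_sum_left: "cinner (sum f F) y = (\<Sum>i\<in>F. cinner (f i) y)" for y :: "'h::complex_hilbert_space"
  by (induction F rule: infinite_finite_induct) (simp_all add: cinner_zero_left cinner_add_left)

lemma cinner_sum_right: "cinner y (sum f F) = (\<Sum>i\<in>F. cinner y (f i))" for y :: "'h::complex_hilbert_space"
  by (induction F rule: infinite_finite_induct) (simp_all add: cinner_zero_right cinner_add_right)

lemma cinner_self: "cinner x x = complex_of_real ((norm x)\<^sup>2)" for x :: "'h::complex_hilbert_space"
proof -
  have "Im (cinner x x) = 0"
    using cinner_commute[of x x] by (metis Reals_cnj_iff complex_is_Real_iff)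
  then show ?thesis
    by (simp add: complex_eq_iff norm_eq_sqrt_cinner cinner_self_nonneg)
qed

lemmas cinner_simps = cinner_add_left cinner_add_right cinner_diff_left cinner_diff_right
  cinner_scaleC_left cinner_scaleC_right cinner_zero_left cinner_zero_right

definition orthonormal_on :: "'i set \<Rightarrow> ('i \<Rightarrow> 'h::complex_hilbert_space) \<Rightarrow> bool"
  where "orthonormal_on I e \<longleftrightarrow> (\<forall>i\<in>I. \<forall>j\<in>I. cinner (e i) (e j) = of_bool (i = j))"

lemma orthonormal_onD: "orthonormal_on I e \<Longrightarrow> i \<in> I \<Longrightarrow> j \<in> I \<Longrightarrow> cinner (e i) (e j) = of_bool (i = j)"
  by (simp add: orthonormal_on_def)

lemma cinner_sum_orthonormal:
  assumes "orthonormal_on I e" "finite F" "F \<subseteq> I" "j \<in> I"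
  shows "cinner (\<Sum>i\<in>F. c i *\<^sub>C e i) (e j) = (if j \<in> F then c j else 0)"
proof -
  have "cinner (\<Sum>i\<in>F. c i *\<^sub>C e i) (e j) = (\<Sum>i\<in>F. c i * of_bool (i = j))"
    by (simp add: cinner_sum_left cinner_simps
        orthonormal_onD[OF assms(1) subsetD[OF assms(3)] assms(4)])
  also have "\<dots> = (if j \<in> F then c j else 0)"
    using assms by (simp add: of_bool_def if_distrib cong: if_cong)
  finally show ?thesis .
qed

lemma norm_sum_orthonormal:
  assumes "orthonormal_on I e" "finite F" "F \<subseteq> I"
  shows "(norm (\<Sum>i\<in>F. c i *\<^sub>C e i))\<^sup>2 = (\<Sum>i\<in>F. (cmod (c i))\<^sup>2)"
proof -
  let ?s = "\<Sum>i\<in>F. c i *\<^sub>C e i"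
  have "complex_of_real ((norm ?s)\<^sup>2) = cinner ?s (\<Sum>i\<in>F. c i *\<^sub>C e i)"
    by (simp only: cinner_self)
  also have "\<dots> = (\<Sum>i\<in>F. cnj (c i) * cinner ?s (e i))"
    by (simp only: cinner_sum_right cinner_scaleC_right)
  also have "\<dots> = (\<Sum>i\<in>F. cnj (c i) * c i)"
    using assms by (intro sum.cong refl) (subst cinner_sum_orthonormal[OF assms(1)], auto)
  also have "\<dots> = complex_of_real (\<Sum>i\<in>F. (cmod (c i))\<^sup>2)"
    by (simp only: of_real_sum complex_norm_square mult.commute)
  finally show ?thesis by (simp only: of_real_eq_iff)
qed

text \<open>The hypothesis says that \<open>x - s\<close> is orthogonal to \<open>s\<close>.\<close>
lemma norm_diff_projection:
  fixes x s :: "'h::complex_hilbert_space"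
  assumes "cinner x s = complex_of_real ((norm s)\<^sup>2)"
  shows "(norm (x - s))\<^sup>2 = (norm x)\<^sup>2 - (norm s)\<^sup>2"
proof -
  have sx: "cinner s x = complex_of_real ((norm s)\<^sup>2)"
    using assms by (metis cinner_commute complex_cnj_complex_of_real)
  have "complex_of_real ((norm (x - s))\<^sup>2) = cinner x x - cinner s x - (cinner x s - cinner s s)"
    by (simp only: cinner_diff_left cinner_diff_right flip: cinner_self)
  also have "\<dots> = complex_of_real ((norm x)\<^sup>2 - (norm s)\<^sup>2)"
    unfolding assms sx cinner_self by simp
  finally show ?thesis by (simp only: of_real_eq_iff)
qed

lemma bessel_finite:
  assumes "orthonormal_on I e" "finite F" "F \<subseteq> I"
  shows "(\<Sum>i\<in>F. (cmod (cinner x (e i)))\<^sup>2) \<le> (norm x)\<^sup>2"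
proof -
  define s where "s = (\<Sum>i\<in>F. cinner x (e i) *\<^sub>C e i)"
  have norm_s: "(norm s)\<^sup>2 = (\<Sum>i\<in>F. (cmod (cinner x (e i)))\<^sup>2)"
    unfolding s_def by (rule norm_sum_orthonormal[OF assms])
  have "cinner x s = (\<Sum>i\<in>F. cnj (cinner x (e i)) * cinner x (e i))"
    by (simp only: s_def cinner_sum_right cinner_scaleC_right)
  also have "\<dots> = complex_of_real ((norm s)\<^sup>2)"
    by (simp only: norm_s of_real_sum complex_norm_square mult.commute)
  finally have "(norm (x - s))\<^sup>2 = (norm x)\<^sup>2 - (norm s)\<^sup>2"
    by (rule norm_diff_projection)
  then have "(norm s)\<^sup>2 \<le> (norm x)\<^sup>2"
    by (metis diff_ge_0_iff_ge zero_le_power2)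
  then show ?thesis by (simp only: norm_s)
qed

text \<open>The case of a single normalized vector in Bessel's inequality.\<close>
lemma cauchy_schwarz: "cmod (cinner x y) \<le> norm x * norm y" for x :: "'h::complex_hilbert_space"
proof (cases "y = 0")
  case False
  define u where "u = complex_of_real (inverse (norm y)) *\<^sub>C y"
  have y: "y = complex_of_real (norm y) *\<^sub>C u"
    using False by (simp add: u_def scaleC_scaleC scaleC_one flip: of_real_mult)
  have "norm u = 1" using False by (simp add: u_def norm_scaleC norm_inverse)
  then have "orthonormal_on {()} (\<lambda>_. u)" by (simp add: orthonormal_on_def cinner_self)
  from bessel_finite[OF this, of "{()}" x] have "cmod (cinner x u) \<le> norm x"
    by (simp add: power2_le_iff_abs_le)
  moreover have "cmod (cinner x y) = norm y * cmod (cinner x u)"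
    by (subst y) (simp add: cinner_simps norm_mult)
  ultimately show ?thesis by (simp only: mult.commute[of "norm x"] mult_left_mono norm_ge_zero)
qed (simp add: cinner_simps)

lemma bounded_linear_cinner: "bounded_linear (\<lambda>x. cinner x y)" for y :: "'h::complex_hilbert_space"
  by (rule bounded_linear_intro[where K = "norm y"])
    (auto simp: cinner_simps scaleR_scaleC scaleR_conv_of_real cauchy_schwarz)

text \<open>Partial sums of the series have the same norms as those of the coefficient sequence, which
  is square summable by Bessel's inequality.\<close>
lemma orthonormal_series:
  assumes "orthonormal_on UNIV e" "orthonormal_on UNIV g"
  shows "summable (\<lambda>k::nat. cinner x (e k) *\<^sub>C g k)"
    and "norm (\<Sum>k. cinner x (e k) *\<^sub>C g k) \<le> norm x"
proof -
  let ?c = "\<lambda>k. cinner x (e k)"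
  have fin: "(\<Sum>k\<in>F. (cmod (?c k))\<^sup>2) \<le> (norm x)\<^sup>2" if "finite F" for F
    using bessel_finite[OF assms(1) that] by simp
  have sq: "(norm (\<Sum>k\<in>F. ?c k *\<^sub>C g k))\<^sup>2 = (\<Sum>k\<in>F. (cmod (?c k))\<^sup>2)" if "finite F" for F
    using norm_sum_orthonormal[OF assms(2) that] by simp
  have "summable (\<lambda>k. (cmod (?c k))\<^sup>2)"
    by (rule summableI_nonneg_bounded[where x = "(norm x)\<^sup>2"]) (auto intro: fin)
  then have cau: "\<exists>N. \<forall>m\<ge>N. \<forall>n. norm (\<Sum>k\<in>{m..<n}. (cmod (?c k))\<^sup>2) < r" if "0 < r" for r
    using that by (simp add: summable_Cauchy)
  show sm: "summable (\<lambda>k. ?c k *\<^sub>C g k)"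
    unfolding summable_Cauchy
  proof (intro allI impI)
    fix r :: real assume r: "0 < r"
    then obtain N where "\<forall>m\<ge>N. \<forall>n. norm (\<Sum>k\<in>{m..<n}. (cmod (?c k))\<^sup>2) < r\<^sup>2"
      using cau[of "r\<^sup>2"] by auto
    then have "\<forall>m\<ge>N. \<forall>n. (norm (\<Sum>k\<in>{m..<n}. ?c k *\<^sub>C g k))\<^sup>2 < r\<^sup>2"
      by (auto simp: sq abs_less_iff)
    then show "\<exists>N. \<forall>m\<ge>N. \<forall>n. norm (\<Sum>k\<in>{m..<n}. ?c k *\<^sub>C g k) < r"
      using r by (meson less_imp_le power_less_imp_less_base)
  qed
  have "norm (\<Sum>k<n. ?c k *\<^sub>C g k) \<le> norm x" for n
    using fin[of "{..<n}"] sq[of "{..<n}"] by (auto intro: power2_le_imp_le)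
  then show "norm (\<Sum>k. ?c k *\<^sub>C g k) \<le> norm x"
    by (rule Lim_norm_ubound[OF sequentially_bot summable_LIMSEQ[OF sm] always_eventually[OF allI]]) 
qed

section \<open>Operators attached to orthonormal sequences\<close>

lemma op_apply_add_right: "op_apply A (x + y) = op_apply A x + op_apply A y"
  by (rule linear_add[OF bounded_linear.linear[OF bounded_linear_op_apply]])

lemma op_apply_diff_right: "op_apply A (x - y) = op_apply A x - op_apply A y"
  by (rule linear_diff[OF bounded_linear.linear[OF bounded_linear_op_apply]])

lemma op_apply_zero_right: "op_apply A 0 = 0"
  by (rule linear_0[OF bounded_linear.linear[OF bounded_linear_op_apply]])

lemma op_apply_sum: "op_apply (sum f F) x = (\<Sum>i\<in>F. op_apply (f i) x)"
  by (induction F rule: infinite_finite_induct) (simp_all add: op_apply_simps)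

text \<open>The operator sending \<open>e k\<close> to \<open>g k\<close> and vanishing on the orthogonal complement of the
  range of \<open>e\<close>. It is a choice among operators with the given values; one exists when both
  sequences are orthonormal.\<close>
definition partial_isometry :: "(nat \<Rightarrow> 'h) \<Rightarrow> (nat \<Rightarrow> 'h) \<Rightarrow> 'h::complex_hilbert_space bounded_op"
  where "partial_isometry e g = (SOME A. \<forall>x. op_apply A x = (\<Sum>k. cinner x (e k) *\<^sub>C g k))"

lemma op_apply_partial_isometry:
  fixes e g :: "nat \<Rightarrow> 'h::complex_hilbert_space"
  assumes "orthonormal_on UNIV e" "orthonormal_on UNIV g"
  shows "op_apply (partial_isometry e g) x = (\<Sum>k. cinner x (e k) *\<^sub>C g k)"
proof -
  let ?f = "\<lambda>x. \<Sum>k. cinner x (e k) *\<^sub>C g k"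
  note sm = orthonormal_series[OF assms]
  have scC: "?f (c *\<^sub>C x) = c *\<^sub>C ?f x" for c x
    using bounded_linear.suminf[OF bounded_linear_scaleC sm(1), of c x]
    by (simp add: cinner_simps scaleC_scaleC)
  have "bounded_linear ?f"
  proof (rule bounded_linear_intro[where K = 1])
    show "?f (x + y) = ?f x + ?f y" for x y
      using suminf_add[OF sm(1) sm(1)] by (simp add: cinner_simps scaleC_add_left)
    show "?f (r *\<^sub>R x) = r *\<^sub>R ?f x" for r x
      using scC[of "complex_of_real r" x] by (simp add: scaleR_scaleC)
    show "norm (?f x) \<le> norm x * 1" for x using sm(2) by simp
  qed
  then have "\<exists>A. op_apply A = ?f" using scC by (simp add: ex_op_apply_eq_iff)
  then have "\<exists>A. \<forall>x. op_apply A x = ?f x" by metis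
  from someI_ex[OF this] show ?thesis by (simp add: partial_isometry_def)
qed

lemma norm_bounded_op_le:
  fixes A :: "'h::complex_normed_vector bounded_op"
  assumes "0 \<le> b" "\<And>x. norm (op_apply A x) \<le> b * norm x" shows "norm A \<le> b"
  using assms by transfer (rule norm_blinfun_bound)

lemma norm_op_apply_le: "norm (op_apply A x) \<le> norm A * norm x"
  by transfer (rule norm_blinfun)

lemma norm_partial_isometry:
  assumes "orthonormal_on UNIV e" "orthonormal_on UNIV g"
  shows "norm (partial_isometry e g) \<le> 1"
  by (rule norm_bounded_op_le) (simp_all add: op_apply_partial_isometry orthonormal_series assms)

lemma cinner_partial_isometry:
  assumes "orthonormal_on UNIV e" "orthonormal_on UNIV g"
  shows "cinner (op_apply (partial_isometry e g) x) (g j) = cinner x (e j)"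
proof -
  have "cinner (op_apply (partial_isometry e g) x) (g j) = (\<Sum>k. cinner (cinner x (e k) *\<^sub>C g k) (g j))"
    by (simp add: op_apply_partial_isometry assms bounded_linear.suminf[OF bounded_linear_cinner] orthonormal_series)
  also have "\<dots> = (\<Sum>k. if k = j then cinner x (e k) else 0)"
    by (simp add: cinner_simps orthonormal_onD[OF assms(2)] of_bool_def if_distrib cong: if_cong)
  also have "\<dots> = cinner x (e j)" by (subst suminf_finite[of "{j}"]) auto
  finally show ?thesis .
qed

text \<open>In particular \<open>partial_isometry g g\<close> is an idempotent, the orthogonal projection onto the
  closed span of the \<open>g k\<close>, and \<open>partial_isometry g e\<close> is a left inverse of
  \<open>partial_isometry e g\<close> when \<open>e\<close> is an orthonormal basis.\<close>
lemma partial_isometry_compose: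
  assumes "orthonormal_on UNIV e" "orthonormal_on UNIV g" "orthonormal_on UNIV h"
  shows "partial_isometry g h * partial_isometry e g = partial_isometry e h"
  using assms
  by (intro bounded_op_eqI) (simp add: op_apply_simps op_apply_partial_isometry[of g h] op_apply_partial_isometry[of e h] cinner_partial_isometry)

text \<open>The operator \<open>x \<otimes> y\<close>.\<close>
definition rank_one :: "'h \<Rightarrow> 'h \<Rightarrow> 'h::complex_hilbert_space bounded_op"
  where "rank_one x y = (SOME A. \<forall>z. op_apply A z = cinner z y *\<^sub>C x)"

lemma op_apply_rank_one: "op_apply (rank_one x y) z = cinner z y *\<^sub>C x"
proof -
  have "bounded_linear (\<lambda>z. cinner z y *\<^sub>C x)"
    by (rule bounded_linear_intro[where K = "norm y * norm x"])
      (auto simp: cinner_simps scaleC_add_left scaleR_scaleC scaleC_scaleC norm_scaleC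
         mult_right_mono cauchy_schwarz simp flip: mult.assoc)
  then have "\<exists>A. op_apply A = (\<lambda>z. cinner z y *\<^sub>C x)"
    by (simp add: ex_op_apply_eq_iff cinner_simps scaleC_scaleC)
  then have "\<exists>A. \<forall>z. op_apply A z = cinner z y *\<^sub>C x" by metis
  from someI_ex[OF this] show ?thesis by (simp add: rank_one_def)
qed

definition id_op :: "'h::complex_normed_vector bounded_op"
  where "id_op = (SOME A. \<forall>z. op_apply A z = z)"

lemma op_apply_id_op: "op_apply id_op z = z"
proof -
  have "\<exists>A::'a bounded_op. op_apply A = (\<lambda>z. z)" by (simp add: ex_op_apply_eq_iff bounded_linear_ident)
  then have "\<exists>A::'a bounded_op. \<forall>z. op_apply A z = z" by metis
  from someI_ex[OF this] show ?thesis by (simp add: id_op_def)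
qed

lemma id_op_mult: "id_op * A = A" "A * id_op = A"
  by (auto intro!: bounded_op_eqI simp: op_apply_simps op_apply_id_op)

lemma rank_one_sandwich:
  "rank_one x y * A * rank_one z w = cinner (op_apply A z) y *\<^sub>C rank_one x w"
  by (rule bounded_op_eqI)
    (simp add: op_apply_simps op_apply_rank_one op_apply_scaleC cinner_simps scaleC_scaleC mult.commute)

text \<open>Polarization: evaluating the form at \<open>x + y\<close> and at \<open>x + \<i> y\<close> separates the two mixed
  terms. The complex scalars matter, a rotation of the real plane by a right angle being a
  counterexample over the reals.\<close>
lemma zero_quadratic_form_imp_zero:
  fixes A :: "'h::complex_hilbert_space bounded_op"
  assumes "\<And>x. cinner (op_apply A x) x = 0"
  shows "A = 0"
proof -
  have "cinner (op_apply A x) y = 0" for x y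
  proof -
    let ?a = "cinner (op_apply A x) y" and ?b = "cinner (op_apply A y) x"
    have 1: "?a + ?b = 0"
      using assms[of "x + y"] by (simp add: op_apply_add_right cinner_simps assms add.commute)
    have "\<i> * ?b - \<i> * ?a = 0"
      using assms[of "x + \<i> *\<^sub>C y"]
      by (simp add: op_apply_add_right op_apply_scaleC cinner_simps assms)
    then have "?b = ?a" by simp
    with 1 show ?thesis by simp
  qed
  then have "op_apply A x = 0" for x by (metis cinner_self_eq_zero)
  then show ?thesis by (intro bounded_op_eqI) (simp add: op_apply_simps)
qed

text \<open>If two orthonormal sequences have finitely many vectors in common, and the remaining vectors
  of the second are orthogonal to the first, then the product of the two projections is
  the projection onto the span of the common vectors.\<close>
lemma partial_isometry_product_finite:
  fixes g h :: "nat \<Rightarrow> 'h::complex_hilbert_space"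
  assumes g: "orthonormal_on UNIV g" and h: "orthonormal_on UNIV h"
    and common: "\<And>k. Q k \<Longrightarrow> h k \<in> range g"
    and orth: "\<And>k j. \<not> Q k \<Longrightarrow> cinner (h k) (g j) = 0"
    and fin: "\<And>k. Q k \<Longrightarrow> k < N"
  shows "partial_isometry g g * partial_isometry h h = (\<Sum>k<N. of_bool (Q k) *\<^sub>C rank_one (h k) (h k))"
proof (rule bounded_op_eqI)
  fix x
  have Tg: "op_apply (partial_isometry g g) (h k) = of_bool (Q k) *\<^sub>C h k" for k
  proof (cases "Q k")
    case True
    then obtain j where j: "h k = g j" using common by blast
    have "op_apply (partial_isometry g g) (g j) = (\<Sum>i. of_bool (j = i) *\<^sub>C g i)"
      using g by (simp add: op_apply_partial_isometry orthonormal_onD[OF g])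
    also have "\<dots> = g j"
      by (subst suminf_finite[of "{j}"]) (auto simp: scaleC_one)
    finally show ?thesis using True j by (simp add: scaleC_one)
  next
    case False
    then show ?thesis using g orth by (simp add: op_apply_partial_isometry)
  qed
  have "op_apply (partial_isometry g g * partial_isometry h h) x
      = (\<Sum>k. op_apply (partial_isometry g g) (cinner x (h k) *\<^sub>C h k))"
    by (simp add: op_apply_simps op_apply_partial_isometry[OF h h]
        bounded_linear.suminf[OF bounded_linear_op_apply] orthonormal_series[OF h h])
  also have "\<dots> = (\<Sum>k. of_bool (Q k) *\<^sub>C cinner x (h k) *\<^sub>C h k)"
    by (simp add: op_apply_scaleC Tg scaleC_scaleC mult.commute)
  also have "\<dots> = (\<Sum>k<N. of_bool (Q k) *\<^sub>C cinner x (h k) *\<^sub>C h k)"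
    using fin by (intro suminf_finite) auto
  finally show "op_apply (partial_isometry g g * partial_isometry h h) x
      = op_apply (\<Sum>k<N. of_bool (Q k) *\<^sub>C rank_one (h k) (h k)) x"
    by (simp add: op_apply_sum op_apply_simps op_apply_rank_one)
qed

section \<open>Separability\<close>

text \<open>The separation may depend on one of the two points. To each \<open>i\<close> belongs a scale
  \<open>1 / (m + 1) < r i\<close> and a point of a countable dense set close to \<open>x i\<close> on that scale; the
  pair determines \<open>i\<close>.\<close>
lemma separated_imp_countable:
  fixes x :: "'i \<Rightarrow> 'a::metric_space"
  assumes sep: "separable_space (euclidean :: 'a topology)"
    and r: "\<And>i. i \<in> I \<Longrightarrow> 0 < r i"
    and dist: "\<And>i j. i \<in> I \<Longrightarrow> j \<in> I \<Longrightarrow> i \<noteq> j \<Longrightarrow> r i \<le> dist (x i) (x j)"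
  shows "countable I"
proof -
  obtain D :: "'a set" where D: "countable D" "closure D = UNIV"
    using sep unfolding separable_space_def by auto
  let ?near = "\<lambda>i md. snd md \<in> D \<and> inverse (real (Suc (fst md))) < r i
    \<and> dist (snd md) (x i) < inverse (real (Suc (fst md))) / 2"
  have "\<exists>md. ?near i md" if i: "i \<in> I" for i
  proof -
    obtain m where m: "inverse (real (Suc m)) < r i"
      using reals_Archimedean[OF r[OF i]] ..
    have "x i \<in> closure D" using D(2) by simp
    then obtain d where "d \<in> D" "dist d (x i) < inverse (real (Suc m)) / 2"
      unfolding closure_approachable
      by (meson half_gt_zero inverse_positive_iff_positive of_nat_0_less_iff zero_less_Suc)
    with m have "?near i (m, d)" by simp
    then show ?thesis ..
  qed
  then have "\<forall>i\<in>I. \<exists>md. ?near i md" by blast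
  from bchoice[OF this] obtain md where md: "\<And>i. i \<in> I \<Longrightarrow> ?near i (md i)" by blast
  have "inj_on md I"
  proof (rule inj_onI)
    fix i j assume ij: "i \<in> I" "j \<in> I" and eq: "md i = md j"
    let ?\<epsilon> = "inverse (real (Suc (fst (md i))))"
    have "dist (x i) (x j) \<le> dist (snd (md i)) (x i) + dist (snd (md i)) (x j)"
      by (simp add: dist_triangle3)
    also have "\<dots> < ?\<epsilon> / 2 + ?\<epsilon> / 2"
      using md[OF ij(1)] md[OF ij(2)] eq by (intro add_strict_mono) simp_all
    also have "\<dots> < r i" using md[OF ij(1)] by simp
    finally have "\<not> r i \<le> dist (x i) (x j)" by simp
    then show "i = j" using dist[OF ij] by blast
  qed
  moreover have "countable (md ` I)"
  proof (rule countable_subset)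
    show "md ` I \<subseteq> UNIV \<times> D" using md by (intro image_subsetI) (simp add: mem_Times_iff)
    show "countable ((UNIV :: nat set) \<times> D)" using D(1) by simp
  qed
  ultimately show ?thesis by (rule countable_image_inj_on[rotated])
qed

text \<open>For \<open>x i\<close> fixed by \<open>E i\<close> one has \<open>E i (x i - x j) = x i\<close>, which bounds the distance of
  \<open>x i\<close> and \<open>x j\<close> from below in terms of \<open>i\<close> alone.\<close>
lemma orthogonal_idempotents_countable:
  fixes E :: "'i \<Rightarrow> 'h::complex_normed_vector bounded_op"
  assumes sep: "separable_space (euclidean :: 'h topology)"
    and E: "\<And>i. i \<in> I \<Longrightarrow> E i \<noteq> 0" "\<And>i. i \<in> I \<Longrightarrow> E i * E i = E i"
    and orth: "\<And>i j. i \<in> I \<Longrightarrow> j \<in> I \<Longrightarrow> i \<noteq> j \<Longrightarrow> E i * E j = 0"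
  shows "countable I"
proof -
  have "\<exists>x. x \<noteq> 0 \<and> op_apply (E i) x = x" if i: "i \<in> I" for i
  proof -
    obtain z where "op_apply (E i) z \<noteq> 0"
      using E(1)[OF i] by (metis bounded_op_eqI op_apply_simps(1))
    then show ?thesis using E(2)[OF i] by (metis op_apply_simps(7))
  qed
  then obtain x where x: "\<And>i. i \<in> I \<Longrightarrow> x i \<noteq> 0" "\<And>i. i \<in> I \<Longrightarrow> op_apply (E i) (x i) = x i"
    by metis
  show ?thesis
  proof (rule separated_imp_countable[OF sep])
    show "0 < norm (x i) / norm (E i)" if "i \<in> I" for i using that x E by simp
    fix i j assume ij: "i \<in> I" "j \<in> I" "i \<noteq> j"
    have "op_apply (E i) (x j) = op_apply (E i * E j) (x j)"
      using x(2)[OF ij(2)] by (simp add: op_apply_simps)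
    then have "op_apply (E i) (x i - x j) = x i"
      using x(2)[OF ij(1)] orth[OF ij] by (simp add: op_apply_diff_right op_apply_simps)
    then have "norm (x i) \<le> norm (E i) * dist (x i) (x j)"
      using norm_op_apply_le[of "E i" "x i - x j"] by (simp add: dist_norm)
    then show "norm (x i) / norm (E i) \<le> dist (x i) (x j)"
      using E(1)[OF ij(1)] by (simp add: divide_le_eq mult.commute)
  qed
qed

text \<open>A maximal orthonormal set works: it is countable because distinct members are at distance
  \<open>\<surd>2\<close>, and infinite because a finite one would span the space.\<close>
lemma ex_orthonormal_basis:
  assumes sep: "separable_space (euclidean :: 'h::complex_hilbert_space topology)"
    and inf: "infinite_dimensional TYPE('h::complex_hilbert_space)"
  obtains e :: "nat \<Rightarrow> 'h::complex_hilbert_space" where "orthonormal_on UNIV e" "partial_isometry e e = id_op"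
proof -
  let ?A = "{B :: 'h set. orthonormal_on B id}"
  have "\<exists>B\<in>?A. \<forall>C\<in>?A. B \<subseteq> C \<longrightarrow> C = B"
  proof (rule subset_Zorn')
    fix C assume C: "subset.chain ?A C"
    have "cinner b c = of_bool (b = c)" if "b \<in> \<Union>C" "c \<in> \<Union>C" for b c
    proof -
      from that obtain X Y where "b \<in> X" "c \<in> Y" "X \<in> C" "Y \<in> C" by blast
      moreover from this have "X \<subseteq> Y \<or> Y \<subseteq> X" "X \<in> ?A" "Y \<in> ?A"
        using C by (auto simp: subset_chain_def)
      ultimately show ?thesis by (auto dest: orthonormal_onD)
    qed
    then show "\<Union>C \<in> ?A" by (simp add: orthonormal_on_def)
  qed
  then obtain B :: "'h set" where B: "orthonormal_on B id"
    and maximal: "\<And>C. orthonormal_on C id \<Longrightarrow> B \<subseteq> C \<Longrightarrow> C = B" by auto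
  have complete: "x = 0" if x: "\<And>b. b \<in> B \<Longrightarrow> cinner x b = 0" for x
  proof (rule ccontr)
    assume "x \<noteq> 0"
    define u where "u = complex_of_real (inverse (norm x)) *\<^sub>C x"
    have norm_u: "norm u = 1"
      using \<open>x \<noteq> 0\<close> by (simp add: u_def norm_scaleC norm_inverse)
    have uB: "cinner u b = 0" if "b \<in> B" for b
      using x[OF that] by (simp add: u_def cinner_scaleC_left)
    have Bu: "cinner b u = 0" if "b \<in> B" for b
      using uB[OF that] cinner_commute[of b u] by simp
    have uu: "cinner u u = 1" by (simp add: cinner_self norm_u)
    have "u \<notin> B"
    proof
      assume "u \<in> B"
      from uB[OF this] uu show False by simp
    qed
    moreover have "orthonormal_on (insert u B) id"
      unfolding orthonormal_on_def
    proof (intro ballI)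
      fix b c assume "b \<in> insert u B" "c \<in> insert u B"
      then show "cinner (id b) (id c) = of_bool (b = c)"
        using \<open>u \<notin> B\<close> uu uB Bu orthonormal_onD[OF B, of b c] by fastforce
    qed
    ultimately show False using maximal by blast
  qed
  have "countable B"
  proof (rule separated_imp_countable[OF sep, where r = "\<lambda>_. 1" and x = id])
    fix b c assume bc: "b \<in> B" "c \<in> B" "b \<noteq> c"
    have "cinner (b - c) (b - c) = 2"
      using orthonormal_onD[OF B] bc by (simp add: cinner_diff_left cinner_diff_right)
    then have "complex_of_real ((norm (b - c))\<^sup>2) = 2" by (simp only: cinner_self)
    then have "(norm (b - c))\<^sup>2 = 2"
      by (metis of_real_eq_iff of_real_numeral)
    then have "1\<^sup>2 \<le> (norm (b - c))\<^sup>2" by simp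
    then have "1 \<le> norm (b - c)" by (rule power2_le_imp_le) simp
    then show "1 \<le> dist (id b) (id c)" by (simp add: dist_norm)
  qed simp
  moreover have "infinite B"
  proof
    assume fin: "finite B"
    have "x \<in> complex_vector.span B" for x
    proof -
      define s where "s = (\<Sum>b\<in>B. cinner x b *\<^sub>C b)"
      have s_span: "s \<in> complex_vector.span B"
        unfolding s_def
        by (intro complex_vector.span_sum complex_vector.span_scale complex_vector.span_base)
      have "cinner s b = cinner x b" if "b \<in> B" for b
        using cinner_sum_orthonormal[OF B fin subset_refl that, of "cinner x"] that
        by (simp add: s_def)
      then have "x - s = 0" by (intro complete) (simp add: cinner_diff_left)
      with s_span show ?thesis by simp
    qed
    then show False using inf fin unfolding infinite_dimensional_def by blast
  qed
  ultimately obtain e where e: "bij_betw e (UNIV :: nat set) B"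
    using bij_betw_from_nat_into by blast
  have on: "orthonormal_on UNIV e"
    using B e by (auto simp: orthonormal_on_def bij_betw_def inj_eq)
  have "x - op_apply (partial_isometry e e) x = 0" for x
  proof (rule complete)
    fix b assume "b \<in> B"
    then obtain j where "b = e j" using e by (auto simp: bij_betw_def)
    then show "cinner (x - op_apply (partial_isometry e e) x) b = 0"
      by (simp add: cinner_diff_left cinner_partial_isometry[OF on on])
  qed
  then have "partial_isometry e e = id_op" by (intro bounded_op_eqI) (simp add: op_apply_id_op)
  with on show ?thesis by (rule that)
qed

section \<open>Jordan homomorphisms\<close>

context
  fixes \<phi> :: "'a::complex_algebra \<Rightarrow> 'b::complex_algebra"
  assumes jordan: "jordan_homomorphism \<phi>"
begin

lemma jordan_add: "\<phi> (a + b) = \<phi> a + \<phi> b"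
  and jordan_scaleC: "\<phi> (c *\<^sub>C a) = c *\<^sub>C \<phi> a"
  and jordan_square: "\<phi> (a * a) = \<phi> a * \<phi> a"
proof -
  interpret Vector_Spaces.linear "(*\<^sub>C)" "(*\<^sub>C)" \<phi>
    using jordan by (simp add: jordan_homomorphism_def)
  show "\<phi> (a + b) = \<phi> a + \<phi> b" "\<phi> (c *\<^sub>C a) = c *\<^sub>C \<phi> a" by (rule add scale)+
  show "\<phi> (a * a) = \<phi> a * \<phi> a" using jordan by (simp add: jordan_homomorphism_def)
qed

lemma jordan_zero: "\<phi> 0 = 0"
  using jordan_add[of 0 0] by simp

lemma jordan_diff: "\<phi> (a - b) = \<phi> a - \<phi> b"
  using jordan_add[of "a - b" b] by simp

lemma jordan_sum: "\<phi> (sum f F) = (\<Sum>i\<in>F. \<phi> (f i))"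
  by (induction F rule: infinite_finite_induct) (simp_all add: jordan_zero jordan_add)

lemma jordan_product: "\<phi> (a * b + b * a) = \<phi> a * \<phi> b + \<phi> b * \<phi> a"
proof -
  have "\<phi> ((a + b) * (a + b)) = \<phi> (a + b) * \<phi> (a + b)" by (rule jordan_square)
  then show ?thesis by (simp add: jordan_add jordan_square distrib_left distrib_right add.commute)
qed

text \<open>With \<open>a \<circ> b = a b + b a\<close>, the identity
  \<open>2 a b a = a \<circ> (a \<circ> b) - a\<^sup>2 \<circ> b\<close> expresses \<open>a b a\<close> by operations that \<open>\<phi>\<close>
  preserves. Linearizing it in \<open>a\<close> gives the next lemma.\<close>
lemma jordan_triple_square: "\<phi> (a * b * a) = \<phi> a * \<phi> b * \<phi> a"
proof -
  have "a * b * a + a * b * a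
      = (a * (a * b + b * a) + (a * b + b * a) * a) - (a * a * b + b * (a * a))"
    by (simp add: algebra_simps)
  then have "\<phi> (a * b * a + a * b * a)
      = \<phi> (a * (a * b + b * a) + (a * b + b * a) * a) - \<phi> ((a * a) * b + b * (a * a))"
    by (metis jordan_diff)
  also have "\<dots> = \<phi> a * \<phi> b * \<phi> a + \<phi> a * \<phi> b * \<phi> a"
    by (simp only: jordan_product jordan_square) (simp add: algebra_simps)
  finally have "2 *\<^sub>R \<phi> (a * b * a) = 2 *\<^sub>R (\<phi> a * \<phi> b * \<phi> a)"
    by (simp add: jordan_add scaleR_2)
  then show ?thesis by simp
qed

lemma jordan_triple: "\<phi> (a * b * c + c * b * a) = \<phi> a * \<phi> b * \<phi> c + \<phi> c * \<phi> b * \<phi> a"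
proof -
  have "\<phi> ((a + c) * b * (a + c)) = \<phi> (a + c) * \<phi> b * \<phi> (a + c)" by (rule jordan_triple_square)
  then show ?thesis
    by (simp add: jordan_add jordan_triple_square distrib_left distrib_right add.commute)
qed

text \<open>A projection \<open>p = v w\<close> that is equivalent to the unit is too large to lie in the kernel of
  a nonzero \<open>\<phi>\<close>. Indeed \<open>w p v + v p w\<close> is the sum of the unit and the idempotent
  \<open>q = v\<^sup>2 w\<^sup>2\<close>, so \<open>\<phi> u = - \<phi> q\<close>; squaring gives \<open>\<phi> u = \<phi> q\<close>.\<close>
lemma jordan_isometry_kernel:
  assumes one: "\<And>a. u * a = a" "\<And>a. a * u = a" 
    and wv: "w * v = u" and ker: "\<phi> (v * w) = 0"
  shows "\<phi> a = 0"
proof -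
  define q where "q = v * v * w * w"
  have wvx: "w * (v * x) = x" for x
    by (metis one(1) wv mult.assoc)
  have "q * q = q" by (simp add: q_def mult.assoc wvx)
  have "\<phi> (w * (v * w) * v + v * (v * w) * w) = 0"
    by (simp only: jordan_triple ker) simp
  moreover have "w * (v * w) * v + v * (v * w) * w = u + q"
    by (simp add: q_def mult.assoc wvx wv)
  ultimately have uq: "\<phi> u = - \<phi> q" by (simp add: jordan_add eq_neg_iff_add_eq_0)
  have "\<phi> u = \<phi> u * \<phi> u" using jordan_square[of u] one(1) by metis
  also have "\<dots> = \<phi> q" using jordan_square[of q] by (simp add: uq \<open>q * q = q\<close>)
  finally have "\<phi> u = - \<phi> u" using uq by simp
  then have "2 *\<^sub>R \<phi> u = 0" by (simp only: scaleR_2 eq_neg_iff_add_eq_0)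
  then have "\<phi> u = 0" by simp
  then show ?thesis using jordan_triple_square[of u a] by (simp add: one)
qed

text \<open>The two images anticommute, and an idempotent anticommuting with an element annihilates it,
  since \<open>p q = p p q = - p q p = q p p = q p\<close>.\<close>
lemma jordan_orthogonal:
  assumes "p * p = p" "\<phi> (p * q) = 0" "\<phi> (q * p) = 0"
  shows "\<phi> p * \<phi> q = 0"
proof -
  let ?p = "\<phi> p" and ?q = "\<phi> q"
  have pp: "?p * ?p = ?p" using jordan_square[of p] assms(1) by metis
  have anti: "?p * ?q = - (?q * ?p)"
    using jordan_product[of p q] assms by (simp add: jordan_add eq_neg_iff_add_eq_0)
  have "?p * ?q = ?p * (?p * ?q)" by (metis pp mult.assoc)
  also have "\<dots> = ?p * (- (?q * ?p))" by (simp only: anti)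
  also have "\<dots> = - (?p * ?q) * ?p" by (simp add: mult.assoc)
  also have "\<dots> = ?q * ?p" using anti pp by (simp add: mult.assoc)
  finally have "?p * ?q = - (?p * ?q)" using anti by simp
  then have "2 *\<^sub>R (?p * ?q) = 0" by (simp only: scaleR_2 eq_neg_iff_add_eq_0)
  then show ?thesis by simp
qed

text \<open>The element \<open>p a\<close> equals both \<open>p a p\<close> and half of \<open>p a + a p\<close>. Comparing the two images
  and multiplying by \<open>\<phi> p\<close> from either side yields
  \<open>\<phi> p \<phi> a = \<phi> p \<phi> a \<phi> p = \<phi> a \<phi> p\<close>.\<close>
lemma jordan_central:
  assumes "p * p = p" "\<And>a. p * a = a * p"
  shows "\<phi> p * \<phi> a = \<phi> a * \<phi> p"
proof -
  let ?p = "\<phi> p" and ?a = "\<phi> a"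
  have pp: "?p * ?p = ?p" using jordan_square[of p] assms(1) by metis
  have "p * a * p = p * a" using assms by (metis mult.assoc)
  then have pa: "\<phi> (p * a) = ?p * ?a * ?p" by (metis jordan_triple_square)
  have *: "?p * ?a + ?a * ?p = ?p * ?a * ?p + ?p * ?a * ?p"
    using jordan_product[of p a] assms(2)[of a, symmetric] by (simp add: jordan_add pa)
  have "?p * (?p * ?a + ?a * ?p) = ?p * (?p * ?a * ?p + ?p * ?a * ?p)" using * by simp
  then have 1: "?p * ?a = ?p * ?a * ?p" using pp
    by (simp add: distrib_left flip: mult.assoc)
  have "(?p * ?a + ?a * ?p) * ?p = (?p * ?a * ?p + ?p * ?a * ?p) * ?p" using * by simp
  then have 2: "?a * ?p = ?p * ?a * ?p" using pp
    by (simp add: distrib_right mult.assoc)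
  show ?thesis using 1 2 by simp
qed

end

section \<open>Bounded sequences of operators\<close>

lemma apply_Bcontfun:
  fixes f :: "nat \<Rightarrow> 'b::real_normed_vector"
  assumes "\<And>n. norm (f n) \<le> b"
  shows "apply_bcontfun (Bcontfun f) = f"
  using assms by (intro Bcontfun_inverse bcontfun_normI) auto

definition single :: "nat \<Rightarrow> 'b::real_normed_vector \<Rightarrow> 'b ell_infty"
  where "single n T = Bcontfun (\<lambda>k. if k = n then T else 0)"

lemma apply_single: "apply_bcontfun (single n T) k = (if k = n then T else 0)"
proof -
  have "apply_bcontfun (single n T) = (\<lambda>k. if k = n then T else 0)"
    unfolding single_def by (rule apply_Bcontfun[where b = "norm T"]) simp
  then show ?thesis by simp
qed

lemmas apply_ell_infty_simps = apply_single times_bcontfun.rep_eq plus_bcontfun.rep_eq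
  scaleC_bcontfun.rep_eq zero_bcontfun.rep_eq

lemma apply_bcontfun_sum: "apply_bcontfun (sum f F) n = (\<Sum>i\<in>F. apply_bcontfun (f i) n)"
  by (induction F rule: infinite_finite_induct) (simp_all add: apply_ell_infty_simps)

lemma single_sandwich: "single n S * A * single n T = single n (S * apply_bcontfun A n * T)"
  by (rule bcontfun_eqI) (simp add: apply_ell_infty_simps)

lemma single_mult: "single n S * single n T = single n (S * T)"
  by (rule bcontfun_eqI) (simp add: apply_ell_infty_simps)

lemma single_scaleC:
  fixes T :: "'b::complex_normed_algebra" shows "single n (c *\<^sub>C T) = c *\<^sub>C single n T"
  by (rule bcontfun_eqI) (simp add: apply_ell_infty_simps)

text \<open>If the quadratic form of \<open>A n\<close> does not vanish at \<open>x\<close>, then compressing \<open>A n\<close> to the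
  line of \<open>x\<close> gives a nonzero multiple of \<open>x \<otimes> x\<close>. The triple product of \<open>y \<otimes> x\<close>,
  \<open>x \<otimes> x\<close> and \<open>x \<otimes> y\<close> then produces a nonzero multiple of \<open>y \<otimes> y\<close>, up to a multiple
  of the element \<open>x \<otimes> x\<close> of the kernel.\<close>
lemma kernel_contains_rank_one:
  fixes \<Phi> :: "'h::complex_hilbert_space bounded_op ell_infty \<Rightarrow> 'b::complex_algebra"
  assumes jordan: "jordan_homomorphism \<Phi>" and A: "\<Phi> A = 0" "apply_bcontfun A n \<noteq> 0"
  shows "\<Phi> (single n (rank_one y y)) = 0"
proof -
  obtain x where x: "cinner (op_apply (apply_bcontfun A n) x) x \<noteq> 0"
    using A(2) zero_quadratic_form_imp_zero by blast
  define c where "c = cinner (op_apply (apply_bcontfun A n) x) x"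
  define p where "p = single n (rank_one x x)"
  have "p * A * p = c *\<^sub>C p"
    by (simp add: p_def c_def single_sandwich rank_one_sandwich single_scaleC)
  then have "c *\<^sub>C \<Phi> p = 0"
    using jordan_triple_square[OF jordan, of p A] A(1) jordan_scaleC[OF jordan, of c p] by simp
  then have p0: "\<Phi> p = 0" using x by (simp add: c_def)
  define v where "v = single n (rank_one y x)"
  define w where "w = single n (rank_one x y)"
  have "x \<noteq> 0" using x by (auto simp: cinner_simps)
  define a where "a = cinner x x * cinner x x"
  define b where "b = cinner y x * cinner x y"
  have "v * p * w + w * p * v = a *\<^sub>C single n (rank_one y y) + b *\<^sub>C p"
    unfolding v_def w_def p_def a_def b_def
    by (simp add: single_sandwich apply_single rank_one_sandwich op_apply_rank_one cinner_simps single_scaleC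
        mult.commute)
  then have "a *\<^sub>C \<Phi> (single n (rank_one y y)) + b *\<^sub>C \<Phi> p = 0"
    using jordan_triple[OF jordan, of v p w] p0 by (simp add: jordan_add[OF jordan] jordan_scaleC[OF jordan])
  then show ?thesis using p0 \<open>x \<noteq> 0\<close> by (simp add: a_def cinner_self_eq_zero)
qed

section \<open>An uncountable family of almost orthogonal idempotents\<close>

text \<open>The number of the prefix of length \<open>m\<close> under an injective numbering of the finite binary words. The
  sets of prefixes of distinct sequences are almost disjoint.\<close>
definition prefix_code :: "(nat \<Rightarrow> bool) \<Rightarrow> nat \<Rightarrow> nat"
  where "prefix_code f m = to_nat (map f [0..<m])"

lemma prefix_code_eqD:
  assumes "prefix_code f i = prefix_code g j" shows "i = j" "m < i \<Longrightarrow> f m = g m"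
proof -
  have eq: "map f [0..<i] = map g [0..<j]" using assms by (simp add: prefix_code_def)
  show "i = j" using arg_cong[OF eq, of length] by simp
  then show "f m = g m" if "m < i" using eq that by simp
qed

lemma uncountable_binary_sequences: "uncountable (UNIV :: (nat \<Rightarrow> bool) set)"
proof
  assume "countable (UNIV :: (nat \<Rightarrow> bool) set)"
  then obtain s :: "nat \<Rightarrow> nat \<Rightarrow> bool" where s: "range s = UNIV"
    using uncountable_def by (metis empty_not_UNIV)
  obtain k where "s k = (\<lambda>n. \<not> s n n)" using s by (metis rangeE UNIV_I)
  then have "s k k = (\<not> s k k)" by metis
  then show False by simp
qed

text \<open>The elements \<open>v f\<close> and \<open>w f\<close> are an isometry and its adjoint, and \<open>v f * w f\<close> is the
  projection \<open>P\<^sub>f\<close> described at the beginning. The right-hand side of the second property is a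
  linear combination of rank-one elements at finitely many indices.\<close>
lemma ex_almost_orthogonal_idempotents:
  fixes e :: "nat \<Rightarrow> 'h::complex_hilbert_space"
  assumes e: "orthonormal_on UNIV e" "partial_isometry e e = id_op"
  obtains v w :: "(nat \<Rightarrow> bool) \<Rightarrow> 'h bounded_op ell_infty"
  where "\<And>f. w f * v f = const_bcontfun id_op"
    and "\<And>f g. f \<noteq> g \<Longrightarrow> \<exists>N c y. (v f * w f) * (v g * w g)
          = (\<Sum>n<N. \<Sum>k<N. c n k *\<^sub>C single n (rank_one (y n k) (y n k)))"
proof -
  define h where "h f n k = e (prefix_code f (n + k))" for f and n k :: nat
  have on: "orthonormal_on UNIV (h f n)" for f n
  proof -
    have "prefix_code f (n + i) = prefix_code f (n + j) \<longleftrightarrow> i = j" for i j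
      using prefix_code_eqD(1)[of f "n + i" f "n + j"] by auto
    then show ?thesis using e(1) by (simp add: orthonormal_on_def h_def)
  qed
  define v where "v f = Bcontfun (\<lambda>n. partial_isometry e (h f n))" for f
  define w where "w f = Bcontfun (\<lambda>n. partial_isometry (h f n) e)" for f
  have v: "apply_bcontfun (v f) n = partial_isometry e (h f n)"
    and w: "apply_bcontfun (w f) n = partial_isometry (h f n) e" for f n
    unfolding v_def w_def by (subst apply_Bcontfun[where b = 1]; simp add: norm_partial_isometry e on)+
  show ?thesis
  proof (rule that)
    show "w f * v f = const_bcontfun id_op" for f
      by (rule bcontfun_eqI)
        (simp add: apply_ell_infty_simps v w partial_isometry_compose e on const_bcontfun.rep_eq)
    fix f g :: "nat \<Rightarrow> bool" assume "f \<noteq> g"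
    then obtain d where d: "f d \<noteq> g d" by blast
    define Q where "Q n k \<longleftrightarrow> prefix_code g (n + k) = prefix_code f (n + k)" for n k
    \<comment> \<open>A common prefix of \<open>f\<close> and \<open>g\<close> cannot reach beyond the position \<open>d\<close> where they
      differ; this bounds at once the indices \<open>n\<close> and the ranks of the entries of the product.\<close>
    have Q: "n + k < Suc d" if "Q n k" for n k
      using prefix_code_eqD(2)[of g "n + k" f "n + k" d] d that by (force simp: Q_def)
    have "(v f * w f) * (v g * w g)
        = (\<Sum>n<Suc d. \<Sum>k<Suc d. of_bool (Q n k) *\<^sub>C single n (rank_one (h g n k) (h g n k)))"
      (is "_ = ?r")
    proof (rule bcontfun_eqI)
      fix n
      have "apply_bcontfun ((v f * w f) * (v g * w g)) n
          = partial_isometry (h f n) (h f n) * partial_isometry (h g n) (h g n)"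
        by (simp add: apply_ell_infty_simps v w partial_isometry_compose e on)
      also have "\<dots> = (\<Sum>k<Suc d. of_bool (Q n k) *\<^sub>C rank_one (h g n k) (h g n k))"
      proof (rule partial_isometry_product_finite[OF on on])
        show "h g n k \<in> range (h f n)" if "Q n k" for k
          using that by (auto simp: Q_def h_def)
        show "cinner (h g n k) (h f n j) = 0" if "\<not> Q n k" for k j
        proof -
          have "prefix_code g (n + k) \<noteq> prefix_code f (n + j)"
            using that prefix_code_eqD(1)[of g "n + k" f "n + j"] by (auto simp: Q_def)
          then show ?thesis using orthonormal_onD[OF e(1)] by (simp add: h_def)
        qed
        show "k < Suc d" if "Q n k" for k using Q[OF that] by simp
      qed
      also have "\<dots> = apply_bcontfun ?r n"
      proof (cases "n < Suc d")
        case True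
        have "apply_bcontfun ?r n = (\<Sum>m<Suc d. if m = n then
            (\<Sum>k<Suc d. of_bool (Q n k) *\<^sub>C rank_one (h g n k) (h g n k)) else 0)"
          unfolding apply_bcontfun_sum
          by (intro sum.cong refl) (auto simp: apply_ell_infty_simps)
        then show ?thesis using True by simp
      next
        case False
        have "apply_bcontfun ?r n = 0"
          using False unfolding apply_bcontfun_sum
          by (intro sum.neutral ballI) (auto simp: apply_ell_infty_simps)
        moreover have "\<not> Q n k" for k using Q[of n k] False by auto
        ultimately show ?thesis by simp
      qed
      finally show "apply_bcontfun ((v f * w f) * (v g * w g)) n = apply_bcontfun ?r n" .
    qed
    then show "\<exists>N c y. (v f * w f) * (v g * w g)
          = (\<Sum>n<N. \<Sum>k<N. c n k *\<^sub>C single n (rank_one (y n k) (y n k)))"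
      by (intro exI[of _ "Suc d"] exI[of _ "\<lambda>n k. of_bool (Q n k)"] exI[of _ "h g"])
  qed
qed

text \<open>Otherwise the almost orthogonal idempotents of the preceding lemma have images that are
  exactly orthogonal, nonzero, and uncountable in number, which separability forbids.\<close>
lemma ex_rank_one_not_in_kernel:
  fixes \<Phi> :: "'h::complex_hilbert_space bounded_op ell_infty \<Rightarrow> 'h bounded_op"
  assumes sep: "separable_space (euclidean :: 'h topology)"
    and inf: "infinite_dimensional TYPE('h)"
    and jordan: "jordan_homomorphism \<Phi>" and nonzero: "\<Phi> A \<noteq> 0"
  shows "\<exists>n y. \<Phi> (single n (rank_one y y)) \<noteq> 0"
proof (rule ccontr)
  assume "\<not> ?thesis"
  then have ker: "\<Phi> (single n (rank_one y y)) = 0" for n y by blast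
  obtain e :: "nat \<Rightarrow> 'h" where e: "orthonormal_on UNIV e" "partial_isometry e e = id_op"
    using ex_orthonormal_basis[OF sep inf] .
  obtain v w :: "(nat \<Rightarrow> bool) \<Rightarrow> 'h bounded_op ell_infty" where wv: "\<And>f. w f * v f = const_bcontfun id_op"
    and prod: "\<And>f g. f \<noteq> g \<Longrightarrow> \<exists>N c y. (v f * w f) * (v g * w g)
          = (\<Sum>n<N. \<Sum>k<N. c n k *\<^sub>C single n (rank_one (y n k) (y n k)))"
    by (rule ex_almost_orthogonal_idempotents[OF e], rule that)
  have unit: "const_bcontfun id_op * a = a" "a * const_bcontfun id_op = a"
    for a :: "'h bounded_op ell_infty"
    by (auto intro!: bcontfun_eqI simp: apply_ell_infty_simps const_bcontfun.rep_eq id_op_mult)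
  define P where "P f = v f * w f" for f
  have PP: "P f * P f = P f" for f
  proof -
    have "P f * P f = v f * (w f * v f) * w f" by (simp only: P_def mult.assoc)
    then show ?thesis by (simp add: wv unit P_def)
  qed
  have P0: "\<Phi> (P f * P g) = 0" if fg: "f \<noteq> g" for f g
  proof -
    obtain N c y where "P f * P g = (\<Sum>n<N. \<Sum>k<N. c n k *\<^sub>C single n (rank_one (y n k) (y n k)))"
      using prod[OF fg] unfolding P_def by blast
    then show ?thesis by (simp add: jordan_sum[OF jordan] jordan_scaleC[OF jordan] ker)
  qed
  have "countable (UNIV :: (nat \<Rightarrow> bool) set)"
  proof (rule orthogonal_idempotents_countable[OF sep, where E = "\<lambda>f. \<Phi> (P f)"])
    show "\<Phi> (P f) \<noteq> 0" for f
      using jordan_isometry_kernel[OF jordan unit wv[of f], of A] nonzero unfolding P_def by blast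
    show "\<Phi> (P f) * \<Phi> (P f) = \<Phi> (P f)" for f
      by (simp add: PP flip: jordan_square[OF jordan])
    show "\<Phi> (P f) * \<Phi> (P g) = 0" if "f \<noteq> g" for f g
      using that by (intro jordan_orthogonal[OF jordan PP] P0) auto
  qed
  then show False using uncountable_binary_sequences by blast
qed

section \<open>Irreducibility\<close>

text \<open>The range of the idempotent \<open>\<phi> p\<close> is its set of fixed points, hence closed, and it is
  invariant because \<open>\<phi> p\<close> commutes with the range of \<open>\<phi>\<close>.\<close>
lemma jordan_central_idempotent:
  fixes \<phi> :: "'a::complex_algebra \<Rightarrow> 'h::complex_normed_vector bounded_op"
  assumes jordan: "jordan_homomorphism \<phi>" and irr: "irreducible_range \<phi>"
    and p: "p * p = p" "\<And>a. p * a = a * p"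
  shows "\<phi> p = 0 \<or> \<phi> p = id_op"
proof -
  let ?E = "op_apply (\<phi> p)"
  define V where "V = {x. ?E x = x}"
  have pp: "?E (?E x) = ?E x" for x
    using jordan_square[OF jordan, of p] p(1) by (metis op_apply_simps(7))
  have "closed V"
    unfolding V_def
    by (intro closed_Collect_eq linear_continuous_on bounded_linear_op_apply continuous_intros)
  moreover have "complex_vector.subspace V"
    by (auto simp: V_def complex_vector.subspace_def op_apply_add_right op_apply_scaleC op_apply_zero_right)
  moreover have "op_apply (\<phi> a) x \<in> V" if "x \<in> V" for a x
    using that jordan_central[OF jordan p, of a] unfolding V_def
    by (metis (mono_tags, lifting) mem_Collect_eq op_apply_simps(7))
  ultimately have "V = {0} \<or> V = UNIV"
    using irr unfolding irreducible_range_def by blast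
  then show ?thesis
  proof
    assume "V = {0}"
    then have "?E x = 0" for x using pp[of x] by (auto simp: V_def)
    then show ?thesis by (intro disjI1 bounded_op_eqI) (simp add: op_apply_simps)
  next
    assume "V = UNIV"
    then have "?E x = x" for x by (auto simp: V_def)
    then show ?thesis by (intro disjI2 bounded_op_eqI) (simp add: op_apply_id_op)
  qed
qed

text \<open>For the zero map every closed subspace is invariant, and the orthogonal complement of a
  nonzero vector is a nontrivial one unless the space is a line.\<close>
lemma irreducible_range_nonzero:
  fixes \<phi> :: "'a \<Rightarrow> 'h::complex_hilbert_space bounded_op"
  assumes irr: "irreducible_range \<phi>" and inf: "infinite_dimensional TYPE('h)"
  obtains a where "\<phi> a \<noteq> 0"
proof (rule ccontr)
  assume "\<not> thesis"
  then have zero: "\<phi> a = 0" for a using that by blast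
  have all: "V = {0} \<or> V = UNIV" if "closed V" "complex_vector.subspace V" for V :: "'h set"
    using irr that complex_vector.subspace_0[OF that(2)]
    unfolding irreducible_range_def by (auto simp: zero op_apply_simps)
  obtain y :: 'h where y: "y \<noteq> 0"
  proof (rule ccontr)
    assume "\<not> thesis"
    then have "(UNIV :: 'h set) = {0}" using that by auto
    then have "complex_vector.span {0 :: 'h} = UNIV" by auto
    then show False using inf unfolding infinite_dimensional_def by blast
  qed
  define V where "V = {x. cinner x y = 0}"
  have "closed V"
    unfolding V_def
    by (intro closed_Collect_eq linear_continuous_on bounded_linear_cinner continuous_intros)
  moreover have "complex_vector.subspace V"
    by (auto simp: V_def complex_vector.subspace_def cinner_simps)
  moreover have "V \<noteq> UNIV" using y cinner_self_eq_zero[of y] by (auto simp: V_def)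
  ultimately have "V = {0}" using all by blast
  have "x \<in> complex_vector.span {y}" for x
  proof -
    have "x - (cinner x y / cinner y y) *\<^sub>C y \<in> V"
      using y by (simp add: V_def cinner_simps cinner_self_eq_zero)
    then have "x = (cinner x y / cinner y y) *\<^sub>C y" using \<open>V = {0}\<close> by simp
    then show ?thesis
      by (metis complex_vector.span_base complex_vector.span_scale singletonI)
  qed
  then have "complex_vector.span {y} = UNIV" by blast
  then show False using inf unfolding infinite_dimensional_def by blast
qed

theorem corollary1:
  fixes \<Phi> :: "'h::complex_hilbert_space bounded_op ell_infty \<Rightarrow> 'h bounded_op"
  assumes "separable_space (euclidean :: 'h topology)"
    and "infinite_dimensional TYPE('h)"
    and "jordan_homomorphism \<Phi>"
    and "irreducible_range \<Phi>"
  shows "\<exists>n. {A. \<Phi> A = 0} = {A. apply_bcontfun A n = 0}"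
proof -
  note jordan = assms(3)
  obtain B where "\<Phi> B \<noteq> 0" using irreducible_range_nonzero[OF assms(4,2)] .
  then obtain n y where ny: "\<Phi> (single n (rank_one y y)) \<noteq> 0"
    using ex_rank_one_not_in_kernel[OF assms(1,2) jordan] by blast
  define p :: "'h bounded_op ell_infty" where "p = single n id_op"
  have pp: "p * p = p" by (simp add: p_def single_mult id_op_mult)
  have pa: "p * a = a * p" for a
    by (rule bcontfun_eqI) (simp add: p_def apply_ell_infty_simps id_op_mult)
  have "\<Phi> p \<noteq> 0"
  proof
    assume "\<Phi> p = 0"
    then have "\<Phi> (p * single n (rank_one y y) * p) = 0"
      by (simp add: jordan_triple_square[OF jordan])
    with ny show False by (simp add: p_def single_mult id_op_mult)
  qed
  then have id: "\<Phi> p = id_op"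
    using jordan_central_idempotent[OF jordan assms(4) pp pa] by blast
  have "\<Phi> A = 0 \<longleftrightarrow> apply_bcontfun A n = 0" for A
  proof
    assume "\<Phi> A = 0"
    then show "apply_bcontfun A n = 0"
      using kernel_contains_rank_one[OF jordan] ny by blast
  next
    assume "apply_bcontfun A n = 0"
    \<comment> \<open>The Jordan product with \<open>\<Phi> p = id_op\<close> is multiplication by 2.\<close>
    then have "p * A + A * p = 0"
      by (intro bcontfun_eqI) (simp add: p_def apply_ell_infty_simps)
    then have "\<Phi> A + \<Phi> A = 0"
      using jordan_product[OF jordan, of p A] by (simp add: id id_op_mult jordan_zero[OF jordan])
    then have "2 *\<^sub>R \<Phi> A = 0" by (simp add: scaleR_2)
    then show "\<Phi> A = 0" by simp
  qed
  then show ?thesis by blast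
qed

end
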